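(* Let $n\ge1$ be an integer, let $1\le i\le n-1$ and let $m>0$ be an integer. Then the $m$th derivative of the Gauss--Legendre polynomial $F^n_i$ is given by $$\frac{d^m}{dt^m}F^n_i(t)=\sum_{k=m}^{n}(k-m+1)_m\,c^{(i)}_{k}\,(t+1)^{k-m}$$ and also by $$\frac{d^m}{dt^m}F^n_i(t)=\frac{(n+1)_m}{2^{m+1}}\left(P_{n-1}(\tau_i)-P_{n-1}(\tau_{i+1})\right)P_{n-m}^{(m)}(t)+\frac{1}{2^{m+1}}\sum_{k=m}^{n-1}(k+1)_m\,d^{(i)}_k\,P_{k-m}^{(m)}(t),$$ where $$c^{(i)}_{k}:=\frac{n}{2k}\left(P_{n-1}(\tau_i)\,b^{(i)}_{k-1}-P_{n-1}(\tau_{i+1})\,b^{(i+1)}_{k-1}\right)\ (1\le k\le n),\qquad d^{(i)}_k:=R_{k}(\tau_{i+1})-R_{k}(\tau_i).$$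
   Context: $(a)_j:=a(a+1)\cdots(a+j-1)$ is the Pochhammer symbol. For $\alpha>-1$, $P^{(\alpha)}_k:=P^{(\alpha,\alpha)}_k$ denotes the symmetric Jacobi polynomial of degree $k$: orthogonal on $[-1,1]$ with respect to $(1-x^2)^\alpha$ and normalized by $P^{(\alpha)}_k(1)=\binom{k+\alpha}{k}$; by convention $P^{(\alpha)}_\ell\equiv0$ for $\ell=-1,-2,\dots$. $P_k:=P^{(0)}_k$ is the Legendre polynomial, and $R_k(t):=P_{k+1}(t)-P_{k-1}(t)$ for $k\ge0$. For the fixed integer $n\ge1$, $-1<\tau_1<\tau_2<\cdots<\tau_n<1$ are the zeros of $P_n$. For $1\le j\le n$, the numbers $b^{(j)}_0,\dots,b^{(j)}_{n-1}$ are defined by $\frac{P_n(x)}{x-\tau_j}=\sum_{k=0}^{n-1}b^{(j)}_k(x+1)^k$. Empty sums are zero. Gauss--Legendre polynomials: set $G^n_0(t)\equiv\frac12$, $G^n_{n+1}(t)\equiv-\frac12$, and for $j=1,\dots,n$ $$G^n_j(t):=\frac{nP_{n-1}(\tau_j)}{2}\int_{-1}^{t}\frac{P_n(x)}{x-\tau_j}\,dx-\frac12 .$$ Then $F^n_j(t):=G^n_j(t)-G^n_{j+1}(t)$ for $j=0,1,\dots,n$. *)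

theory Defs
  imports
    "HOL-Analysis.Analysis"
    "HOL-Computational_Algebra.Computational_Algebra"
begin

definition sym_jacobi_system :: "real \<Rightarrow> (nat \<Rightarrow> real poly) \<Rightarrow> bool" where
  "sym_jacobi_system \<alpha> P \<longleftrightarrow>
     (\<forall>k. degree (P k) = k) \<and>
     (\<forall>k l. k \<noteq> l \<longrightarrow>
        ((\<lambda>x. poly (P k) x * poly (P l) x * (1 - x\<^sup>2) powr \<alpha>) has_integral 0) {-1..1}) \<and>
     (\<forall>k. poly (P k) 1 = (real k + \<alpha>) gchoose k)"

text \<open>For \<open>\<alpha> > -1\<close> there is exactly one such system. The degree index is an integer, because
  polynomials of negative degree index are 0 by convention.\<close>

definition sym_jacobi :: "real \<Rightarrow> int \<Rightarrow> real poly" where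
  "sym_jacobi \<alpha> k = (if k < 0 then 0 else (THE P. sym_jacobi_system \<alpha> P) (nat k))"

definition legendre :: "int \<Rightarrow> real poly" where
  "legendre k = sym_jacobi 0 k"

definition legendre_R :: "nat \<Rightarrow> real \<Rightarrow> real" where
  "legendre_R k t = poly (legendre (int k + 1)) t - poly (legendre (int k - 1)) t"

text \<open>The zeros \<open>\<tau>\<^sub>1 < \<dots> < \<tau>\<^sub>n\<close>, hence indices run from 1.\<close>

definition gl_node :: "nat \<Rightarrow> nat \<Rightarrow> real" where
  "gl_node n j = sorted_list_of_set {x. poly (legendre (int n)) x = 0} ! (j - 1)"

text \<open>The point \<open>x = \<tau>\<^sub>j\<close> is excluded because division by zero yields 0.\<close>

definition gl_b :: "nat \<Rightarrow> nat \<Rightarrow> nat \<Rightarrow> real" where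
  "gl_b n j = (THE b. (\<forall>k\<ge>n. b k = 0) \<and>
     (\<forall>x. x \<noteq> gl_node n j \<longrightarrow>
        poly (legendre (int n)) x / (x - gl_node n j) = (\<Sum>k<n. b k * (x + 1) ^ k)))"

text \<open>The oriented integral makes the formula valid for \<open>t < -1\<close> as well; the value of the
  integrand at \<open>x = \<tau>\<^sub>j\<close> is irrelevant.\<close>

definition gl_G :: "nat \<Rightarrow> nat \<Rightarrow> real \<Rightarrow> real" where
  "gl_G n j t =
     (if j = 0 then 1 / 2
      else if j = n + 1 then - 1 / 2
      else real n * poly (legendre (int n - 1)) (gl_node n j) / 2 *
             (LBINT x=-1..ereal t. poly (legendre (int n)) x / (x - gl_node n j)) - 1 / 2)"

definition gl_F :: "nat \<Rightarrow> nat \<Rightarrow> real \<Rightarrow> real" where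
  "gl_F n j t = gl_G n j t - gl_G n (j + 1) t"

definition gl_c :: "nat \<Rightarrow> nat \<Rightarrow> nat \<Rightarrow> real" where
  "gl_c n i k = real n / (2 * real k) *
     (poly (legendre (int n - 1)) (gl_node n i) * gl_b n i (k - 1) -
      poly (legendre (int n - 1)) (gl_node n (i + 1)) * gl_b n (i + 1) (k - 1))"

definition gl_d :: "nat \<Rightarrow> nat \<Rightarrow> nat \<Rightarrow> real" where
  "gl_d n i k = legendre_R k (gl_node n (i + 1)) - legendre_R k (gl_node n i)"

end

theory Submission
  imports Defs
begin

text \<open>
  Both expansions come from writing \<open>F\<^sub>i\<close> as a polynomial and differentiating it termwise.

  For the first one, integrating \<open>P\<^sub>n(x)/(x - \<tau>\<^sub>j) = \<Sum> b\<^sub>k (x + 1)\<^sup>k\<close> from \<open>-1\<close> gives \<open>G\<^sub>j\<close> in powers of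
  \<open>t + 1\<close>; the constants \<open>-1/2\<close> cancel in \<open>F\<^sub>i = G\<^sub>i - G\<^sub>i\<^sub>+\<^sub>1\<close> (lemma \<open>gl_F_eq\<close>).

  For the second one, put \<open>y = \<tau>\<^sub>j\<close> in the Christoffel--Darboux identity: as \<open>P\<^sub>n(\<tau>\<^sub>j) = 0\<close>, it says
  \<open>n P\<^sub>n\<^sub>-\<^sub>1(\<tau>\<^sub>j) P\<^sub>n(x)/(x - \<tau>\<^sub>j) = \<Sum>\<^bsub>k<n\<^esub> (2k + 1) P\<^sub>k(x) P\<^sub>k(\<tau>\<^sub>j)\<close>, so the derivative of \<open>G\<^sub>j\<close> is half of
  the Christoffel--Darboux kernel (lemma \<open>gl_b_kernel\<close>). Since \<open>(2k + 1) P\<^sub>k\<close> is the derivative of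
  \<open>P\<^sub>k\<^sub>+\<^sub>1 - P\<^sub>k\<^sub>-\<^sub>1\<close>, summation by parts moves the difference \<open>R\<^sub>k\<close> from the variable \<open>x\<close> to
  the node (lemma \<open>pderiv_kernel_antiderivative\<close>) and yields, up to a constant,
  \<open>2 G\<^sub>j = P\<^sub>n\<^sub>-\<^sub>1(\<tau>\<^sub>j) P\<^sub>n - \<Sum>\<^bsub>k<n\<^esub> R\<^sub>k(\<tau>\<^sub>j) P\<^sub>k\<close>. For \<open>m > 0\<close> the constant disappears, and the \<open>m\<close>-th
  derivative of a Legendre polynomial is a multiple of a symmetric Jacobi polynomial with parameter
  \<open>m\<close> (lemma \<open>pderiv_funpow_Leg\<close>).

  The symmetric Jacobi polynomials are given by a definite description. To evaluate it, Legendre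
  polynomials are constructed from the three-term recurrence. The Legendre differential equation,
  differentiated \<open>m\<close> times, is a Sturm--Liouville equation with weight \<open>(1 - x\<^sup>2)\<^sup>m\<close>. It gives the
  orthogonality of the \<open>m\<close>-th derivatives and their values at 1, so the rescaled derivatives satisfy
  the description for the parameter \<open>m\<close>; an orthogonality argument shows that nothing else does.
  The same equation supplies the \<open>n\<close> real zeros of \<open>P\<^sub>n\<close> through Rolle's theorem, which is what
  makes the indices \<open>i\<close> and \<open>i + 1\<close> refer to actual zeros.
\<close>

section \<open>Legendre polynomials from the three-term recurrence\<close>

fun Leg :: "nat \<Rightarrow> real poly" where
  "Leg 0 = 1"
| "Leg (Suc 0) = [:0, 1:]"
| "Leg (Suc (Suc k)) = smult (1 / (real k + 2))
     (smult (2 * real k + 3) ([:0, 1:] * Leg (Suc k)) - smult (real k + 1) (Leg k))"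

lemma Leg_recurrence:
  "(real k + 2) * poly (Leg (Suc (Suc k))) x =
     (2 * real k + 3) * x * poly (Leg (Suc k)) x - (real k + 1) * poly (Leg k) x"
  by (simp add: field_simps)

lemma pderiv_Leg_recurrence:
  "(real k + 2) * poly (pderiv (Leg (Suc (Suc k)))) x =
     (2 * real k + 3) * (poly (Leg (Suc k)) x + x * poly (pderiv (Leg (Suc k))) x)
     - (real k + 1) * poly (pderiv (Leg k)) x"
  by (simp add: pderiv_smult pderiv_diff pderiv_mult pderiv_pCons field_simps)

declare Leg.simps(3) [simp del]

lemma degree_Leg_aux: "degree (Leg k) \<le> k \<and> coeff (Leg k) k > 0"
proof (induction k rule: Leg.induct)
  case (3 k)
  have d: "degree (Leg k) \<le> k" "degree (Leg (Suc k)) \<le> Suc k" "coeff (Leg (Suc k)) (Suc k) > 0"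
    using 3 by auto
  have "degree ([:0, 1:] * Leg (Suc k)) \<le> Suc (Suc k)"
    using d(2) degree_mult_le[of "[:0, 1:]" "Leg (Suc k)"] by simp
  hence "degree (Leg (Suc (Suc k))) \<le> Suc (Suc k)"
    unfolding Leg.simps(3) using d(1)
    by (intro order.trans[OF degree_smult_le] degree_diff_le) 
       (auto intro: order.trans[OF degree_smult_le])
  moreover have "coeff (Leg k) (Suc (Suc k)) = 0"
    using d(1) by (intro coeff_eq_0) auto
  ultimately show ?case using d(3) by (simp add: Leg.simps(3))
qed simp_all

lemma degree_Leg: "degree (Leg k) = k"
  using degree_Leg_aux[of k] by (metis le_antisym le_degree less_irrefl)

text \<open>The two relations have to be proved together: each step of the induction needs both
  of them for the preceding index. Every later identity for derivatives follows from them.\<close>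

lemma Leg_derivative_relations:
  "poly (pderiv (Leg (Suc k))) x = x * poly (pderiv (Leg k)) x + (real k + 1) * poly (Leg k) x \<and>
   x * poly (pderiv (Leg (Suc k))) x - poly (pderiv (Leg k)) x = (real k + 1) * poly (Leg (Suc k)) x"
proof (induction k)
  case 0
  show ?case by (simp add: pderiv_pCons)
next
  case (Suc k)
  let ?p = "poly (Leg k) x" and ?q = "poly (Leg (Suc k)) x" and ?r = "poly (Leg (Suc (Suc k))) x"
  let ?p' = "poly (pderiv (Leg k)) x" and ?q' = "poly (pderiv (Leg (Suc k))) x"
    and ?r' = "poly (pderiv (Leg (Suc (Suc k)))) x"
  have A: "?q' = x * ?p' + (real k + 1) * ?p" and B: "x * ?q' - ?p' = (real k + 1) * ?q"
    using Suc by auto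
  have "(real k + 2) * ?r' = (real k + 2) * (x * ?q' + (real k + 2) * ?q)"
    unfolding pderiv_Leg_recurrence using B by algebra
  hence A': "?r' = x * ?q' + (real k + 2) * ?q" by simp
  have "x * ?r' - ?q' = (real k + 2) * ?r"
    unfolding Leg_recurrence A' using A B by algebra
  with A' show ?case by (simp add: algebra_simps)
qed

lemmas pderiv_Leg_Suc = Leg_derivative_relations[THEN conjunct1]
  and pderiv_Leg_lower = Leg_derivative_relations[THEN conjunct2]

text \<open>This makes \<open>Leg (k + 2) - Leg k\<close> an antiderivative of a multiple of \<open>Leg (k + 1)\<close>, which is what
  the summation by parts below rests on.\<close>

lemma pderiv_Leg_diff:
  "poly (pderiv (Leg (Suc (Suc k)))) x - poly (pderiv (Leg k)) x = (2 * real k + 3) * poly (Leg (Suc k)) x"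
  using pderiv_Leg_Suc[of "Suc k" x] pderiv_Leg_lower[of x k]
  by (simp add: algebra_simps)

section \<open>The differential equation and its consequences\<close>

lemma Leg_ode:
  "(1 - x\<^sup>2) * poly (pderiv (pderiv (Leg k))) x - 2 * x * poly (pderiv (Leg k)) x
     + real k * (real k + 1) * poly (Leg k) x = 0"
proof (cases k)
  case (Suc j)
  have "[:1, 0, -1:] * pderiv (Leg (Suc j)) = smult (real j + 1) (Leg j - [:0, 1:] * Leg (Suc j))"
  proof (rule poly_ext)
    fix x
    have "(1 - x\<^sup>2) * poly (pderiv (Leg (Suc j))) x = (real j + 1) * (poly (Leg j) x - x * poly (Leg (Suc j)) x)"
      using pderiv_Leg_Suc[of j x] pderiv_Leg_lower[of x j] by algebra
    thus "poly ([:1, 0, -1:] * pderiv (Leg (Suc j))) x = poly (smult (real j + 1) (Leg j - [:0, 1:] * Leg (Suc j))) x"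
      by (simp add: power2_eq_square algebra_simps)
  qed
  hence "poly (pderiv ([:1, 0, -1:] * pderiv (Leg (Suc j)))) x
       = poly (pderiv (smult (real j + 1) (Leg j - [:0, 1:] * Leg (Suc j)))) x" by simp
  hence "(1 - x\<^sup>2) * poly (pderiv (pderiv (Leg k))) x - 2 * x * poly (pderiv (Leg k)) x =
      (real j + 1) * (poly (pderiv (Leg j)) x - poly (Leg k) x - x * poly (pderiv (Leg k)) x)"
    unfolding Suc pderiv_mult pderiv_smult pderiv_diff by (simp add: pderiv_pCons power2_eq_square algebra_simps)
  also have "\<dots> = - (real j + 1) * (real j + 2) * poly (Leg k) x"
    unfolding Suc using pderiv_Leg_lower[of x j] by algebra
  finally show ?thesis
    unfolding Suc by (simp add: algebra_simps)
qed simp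

lemma Leg_ode_deriv:
  "(1 - x\<^sup>2) * poly ((pderiv ^^ Suc (Suc m)) (Leg k)) x
     - 2 * (real m + 1) * x * poly ((pderiv ^^ Suc m) (Leg k)) x
     + (real k - real m) * (real k + real m + 1) * poly ((pderiv ^^ m) (Leg k)) x = 0"
proof (induction m arbitrary: x)
  case 0
  show ?case using Leg_ode[of x k] by (simp add: algebra_simps)
next
  case (Suc m)
  let ?y = "\<lambda>j. (pderiv ^^ j) (Leg k)"
  let ?E = "[:1, 0, -1:] * ?y (Suc (Suc m)) - [:0, 2 * (real m + 1):] * ?y (Suc m)
    + smult ((real k - real m) * (real k + real m + 1)) (?y m)"
  have "?E = 0"
    by (rule poly_ext) (use Suc in \<open>simp add: power2_eq_square algebra_simps\<close>)
  hence "poly (pderiv ?E) x = 0" by simp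
  thus ?case
    by (simp add: pderiv_mult pderiv_smult pderiv_diff pderiv_add pderiv_minus pderiv_pCons power2_eq_square algebra_simps)
qed

text \<open>The differentiated equation in self-adjoint form; it is multiplied by \<open>(1 - x\<^sup>2)\<^sup>m\<close>, so that its first
  two terms become a single derivative.\<close>

lemma Leg_sturm_liouville:
  "((\<lambda>x. (1 - x\<^sup>2) ^ Suc m * poly ((pderiv ^^ Suc m) (Leg k)) x) has_real_derivative
     - (real k - real m) * (real k + real m + 1) * ((1 - x\<^sup>2) ^ m * poly ((pderiv ^^ m) (Leg k)) x))
     (at x within A)"
proof -
  let ?u = "1 - x\<^sup>2" and ?y = "\<lambda>j. poly ((pderiv ^^ j) (Leg k))"
  have "((\<lambda>x. 1 - x\<^sup>2) has_real_derivative - 2 * x) (at x within A)"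
    by (auto intro!: derivative_eq_intros)
  from DERIV_power_Suc[OF this, of m]
  have d: "((\<lambda>x. (1 - x\<^sup>2) ^ Suc m * ?y (Suc m) x) has_real_derivative
     - (real m + 1) * 2 * x * ?u ^ m * ?y (Suc m) x + ?u ^ Suc m * ?y (Suc (Suc m)) x) (at x within A)"
    by (rule DERIV_cong[OF DERIV_mult[OF _ poly_DERIV[THEN DERIV_subset]]]) (auto simp: algebra_simps)
  have "- (real m + 1) * 2 * x * ?u ^ m * ?y (Suc m) x + ?u ^ Suc m * ?y (Suc (Suc m)) x
     = ?u ^ m * (?u * ?y (Suc (Suc m)) x - 2 * (real m + 1) * x * ?y (Suc m) x)"
    by (simp add: algebra_simps)
  also have "?u * ?y (Suc (Suc m)) x - 2 * (real m + 1) * x * ?y (Suc m) x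
     = - (real k - real m) * (real k + real m + 1) * ?y m x"
    using Leg_ode_deriv[of x m k] by algebra
  also have "?u ^ m * \<dots> = - (real k - real m) * (real k + real m + 1) * (?u ^ m * ?y m x)"
    by (simp only: mult_ac)
  finally show ?thesis by (rule DERIV_cong[OF d])
qed

lemma Leg_at_1: "poly (Leg k) 1 = 1"
proof (induction k rule: Leg.induct)
  case (3 k)
  have "(real k + 2) * poly (Leg (Suc (Suc k))) 1 = (real k + 2) * 1"
    unfolding Leg_recurrence using 3 by simp
  thus ?case by (metis add_nonneg_pos less_irrefl mult_left_cancel of_nat_0_le_iff zero_less_numeral)
qed simp_all

text \<open>At \<open>x = 1\<close> the leading coefficient of the differential equation vanishes, and what remains is a
  first-order recursion in \<open>m\<close> for the values at 1.\<close>

lemma pderiv_Leg_at_1: 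
  "m \<le> k \<Longrightarrow> 2 ^ m * fact m * fact (k - m) * poly ((pderiv ^^ m) (Leg k)) 1 = (fact (k + m) :: real)"
proof (induction m)
  case (Suc m)
  let ?y = "\<lambda>j. poly ((pderiv ^^ j) (Leg k)) 1"
  have e: "2 * (real m + 1) * ?y (Suc m) = (real k - real m) * (real k + real m + 1) * ?y m"
    using Leg_ode_deriv[of 1 m k] by (simp del: funpow.simps)
  have f: "fact (k - m) = (real k - real m) * fact (k - Suc m)"
    using Suc.prems by (simp add: fact_reduce[of "k - m"] of_nat_diff)
  have "2 ^ Suc m * fact (Suc m) * fact (k - Suc m) * ?y (Suc m)
      = 2 ^ m * fact m * fact (k - Suc m) * (2 * (real m + 1) * ?y (Suc m))"
    by (simp add: algebra_simps del: funpow.simps)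
  also have "\<dots> = (real k + real m + 1) * (2 ^ m * fact m * fact (k - m) * ?y m)"
    unfolding e f by (simp only: mult_ac)
  also have "2 ^ m * fact m * fact (k - m) * ?y m = fact (k + m)"
    using Suc by simp
  finally show ?case by (simp add: algebra_simps)
qed (simp add: Leg_at_1)

text \<open>Eigenfunctions of one Sturm--Liouville problem with different eigenvalues are orthogonal: the
  weighted product is, up to the difference of the eigenvalues, the derivative of a
  Wronskian-like function that vanishes at both endpoints.\<close>

lemma Leg_deriv_orthogonal:
  assumes "k \<noteq> l"
  shows "((\<lambda>x. (1 - x\<^sup>2) ^ m * (poly ((pderiv ^^ m) (Leg k)) x * poly ((pderiv ^^ m) (Leg l)) x))
     has_integral 0) {-1..1}"
proof -
  let ?y = "\<lambda>k j x. poly ((pderiv ^^ j) (Leg k)) x"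
  let ?l = "\<lambda>k. (real k - real m) * (real k + real m + 1)"
  let ?w = "\<lambda>x::real. (1 - x\<^sup>2)"
  let ?f = "\<lambda>x. ?w x ^ Suc m * ?y k (Suc m) x * ?y l m x - ?w x ^ Suc m * ?y l (Suc m) x * ?y k m x"
  \<comment> \<open>The terms with two first-order derivatives cancel by symmetry.\<close>
  have d: "(?f has_real_derivative 
      (?l l - ?l k) * (?w x ^ m * (?y k m x * ?y l m x))) (at x within A)" for x A
    by (rule derivative_eq_intros Leg_sturm_liouville poly_DERIV[THEN DERIV_subset] subset_UNIV refl)+
       (simp add: algebra_simps)
  have "((\<lambda>x. (?l l - ?l k) * (?w x ^ m * (?y k m x * ?y l m x))) has_integral (?f 1 - ?f (-1))) {-1..1}"
    by (rule fundamental_theorem_of_calculus)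
       (use d in \<open>auto simp: has_real_derivative_iff_has_vector_derivative\<close>)
  hence "((\<lambda>x. (?l l - ?l k) * (?w x ^ m * (?y k m x * ?y l m x))) has_integral 0) {-1..1}"
    by simp
  moreover have "?l l - ?l k = (real l - real k) * (real l + real k + 1)" by algebra
  hence "?l l - ?l k \<noteq> 0" using assms by (simp add: add_nonneg_eq_0_iff)
  ultimately show ?thesis
    using has_integral_mult_right[of "\<lambda>x. (?l l - ?l k) * (?w x ^ m * (?y k m x * ?y l m x))" 0 "{-1..1}" "1 / (?l l - ?l k)"]
    by simp
qed

section \<open>Identification of the symmetric Jacobi polynomials\<close>

text \<open>The constant undoes the factor that differentiation produces, so that the value at 1 becomes the
  required binomial coefficient.\<close>

definition Jac :: "nat \<Rightarrow> nat \<Rightarrow> real poly" where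
  "Jac m k = smult (2 ^ m / pochhammer (real k + real m + 1) m) ((pderiv ^^ m) (Leg (k + m)))"

text \<open>For \<open>m = 0\<close> the two weights differ at \<open>\<plusminus>1\<close>, because \<open>0 powr 0 = 0\<close>; two points do not affect
  the integral.\<close>

lemma weight_has_integral_iff:
  "((\<lambda>x::real. f x * (1 - x\<^sup>2) powr real m) has_integral I) {-1..1} \<longleftrightarrow>
   ((\<lambda>x. (1 - x\<^sup>2) ^ m * f x) has_integral (I::real)) {-1..1}"
proof (rule has_integral_spike_finite_eq[of "{-1, 1}"])
  fix x :: real
  assume "x \<in> {-1..1} - {-1, 1}"
  hence "1 - x\<^sup>2 > 0" by (auto simp: abs_square_less_1)
  thus "(1 - x\<^sup>2) ^ m * f x = f x * (1 - x\<^sup>2) powr real m"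
    by (simp add: powr_realpow)
qed simp

lemma fact_add_pochhammer: "fact (k + m) = fact k * pochhammer (real k + 1) m"
  using pochhammer_product'[of "1::real" k m] by (simp add: pochhammer_fact add_ac)

lemma sym_jacobi_system_Jac: "sym_jacobi_system (real m) (Jac m)"
  unfolding sym_jacobi_system_def
proof (intro conjI allI impI)
  fix k l :: nat
  have nz: "pochhammer (real k + real m + 1) m > 0" for k
    by (rule pochhammer_pos) simp
  show "degree (Jac m k) = k"
    using nz[of k] by (simp add: Jac_def degree_higher_pderiv degree_Leg)
  show "poly (Jac m k) 1 = (real k + real m) gchoose k"
  proof -
    have "2 ^ m * fact m * fact k * poly ((pderiv ^^ m) (Leg (k + m))) 1 
        = (fact (k + m) * pochhammer (real k + real m + 1) m :: real)"
      using pderiv_Leg_at_1[of m "k + m"] fact_add_pochhammer[of "k + m" m] by simp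
    hence "poly (Jac m k) 1 = fact (k + m) / (fact m * fact k)"
      using nz[of k] by (simp add: Jac_def field_simps)
    also have "\<dots> = (real k + real m) gchoose k"
      using binomial_fact[of k "k + m", where 'a = real] by (simp add: binomial_gbinomial mult.commute)
    finally show ?thesis .
  qed
  assume "k \<noteq> l"
  define c where "c = (\<lambda>k. 2 ^ m / pochhammer (real k + real m + 1) m)"
  from \<open>k \<noteq> l\<close> show "((\<lambda>x. poly (Jac m k) x * poly (Jac m l) x * (1 - x\<^sup>2) powr real m) has_integral 0) {-1..1}"
    unfolding weight_has_integral_iff
    using has_integral_mult_right[OF Leg_deriv_orthogonal[of "k + m" "l + m" m], of "c k * c l"]
    by (simp add: Jac_def c_def mult_ac)
qed

lemma poly_in_span:
  fixes P :: "nat \<Rightarrow> real poly"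
  assumes deg: "\<And>k. degree (P k) = k" and P0: "P 0 \<noteq> 0"
  shows "\<exists>a. p = (\<Sum>j\<le>degree p. smult (a j) (P j))"
proof -
  have "degree p \<le> n \<Longrightarrow> \<exists>a. p = (\<Sum>j\<le>n. smult (a j) (P j))" for n
  proof (induction n arbitrary: p)
    case 0
    then obtain c where "p = [:c:]" using degree0_coeffs[of p] by auto
    moreover obtain b where b: "P 0 = [:b:]" using degree0_coeffs[of "P 0"] deg by auto
    ultimately have "p = smult (c / b) (P 0)" using P0 by auto
    thus ?case by (intro exI[of _ "\<lambda>_. c / b"]) simp
  next
    case (Suc n)
    let ?q = "P (Suc n)"
    have nz: "coeff ?q (Suc n) \<noteq> 0"
      using deg[of "Suc n"] by (metis degree_0 leading_coeff_0_iff nat.distinct(1))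
    define c where "c = coeff p (Suc n) / coeff ?q (Suc n)"
    have "degree (p - smult c ?q) \<le> Suc n"
      using Suc.prems deg[of "Suc n"] by (intro degree_diff_le) (auto intro: order.trans[OF degree_smult_le])
    moreover have "coeff (p - smult c ?q) (Suc n) = 0" using nz by (simp add: c_def)
    ultimately have "degree (p - smult c ?q) \<le> n"
      by (metis degree_0 le_SucE le_zero_eq leading_coeff_0_iff zero_le)
    from Suc.IH[OF this] obtain a where "p - smult c ?q = (\<Sum>j\<le>n. smult (a j) (P j))" by blast
    hence "p = (\<Sum>j\<le>Suc n. smult ((a(Suc n := c)) j) (P j))"
      by (simp add: algebra_simps)
    thus ?case by blast
  qed
  thus ?thesis by blast
qed

lemma sym_jacobi_system_orthogonal_lower:
  assumes P: "sym_jacobi_system (real m) P" and q: "degree q < k"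
  shows "((\<lambda>x. (1 - x\<^sup>2) ^ m * (poly (P k) x * poly q x)) has_integral 0) {-1..1}"
proof -
  have deg: "degree (P k) = k" and one: "poly (P k) 1 = (real k + real m) gchoose k" for k
    using P unfolding sym_jacobi_system_def by auto
  from poly_in_span[of P q] deg one[of 0] 
  obtain a where a: "q = (\<Sum>j\<le>degree q. smult (a j) (P j))" by fastforce
  have "((\<lambda>x. \<Sum>j\<le>degree q. a j * ((1 - x\<^sup>2) ^ m * (poly (P k) x * poly (P j) x))) 
      has_integral (\<Sum>j\<le>degree q. a j * 0)) {-1..1}"
  proof (intro has_integral_sum has_integral_mult_right)
    fix j assume "j \<in> {..degree q}"
    with q have "k \<noteq> j" by auto
    with P show "((\<lambda>x. (1 - x\<^sup>2) ^ m * (poly (P k) x * poly (P j) x)) has_integral 0) {-1..1}"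
      unfolding sym_jacobi_system_def weight_has_integral_iff by blast
  qed simp
  moreover have "(\<Sum>j\<le>degree q. a j * ((1 - x\<^sup>2) ^ m * (poly (P k) x * poly (P j) x))) =
     (1 - x\<^sup>2) ^ m * (poly (P k) x * poly q x)" for x
    by (subst (2) a) (simp add: poly_sum sum_distrib_left mult_ac)
  ultimately show ?thesis by simp
qed

lemma weighted_square_integral_0:
  fixes p :: "real poly"
  assumes "((\<lambda>x. (1 - x\<^sup>2) ^ m * (poly p x * poly p x)) has_integral 0) {-1..1}"
  shows "p = 0"
proof -
  have "poly p x = 0" if "x \<in> {-1<..<1}" for x
  proof -
    have "(1 - x\<^sup>2) ^ m * (poly p x * poly p x) = 0"
    proof (rule has_integral_0_cbox_imp_0[where a = "-1" and b = 1
        and f = "\<lambda>x. (1 - x\<^sup>2) ^ m * (poly p x * poly p x)"])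
      show "continuous_on (cbox (-1) 1) (\<lambda>x. (1 - x\<^sup>2) ^ m * (poly p x * poly p x))"
        by (intro continuous_intros)
      show "0 \<le> (1 - x\<^sup>2) ^ m * (poly p x * poly p x)" if "x \<in> box (-1) (1::real)" for x
        using that by (intro mult_nonneg_nonneg[OF zero_le_power zero_le_square]) (auto simp: abs_square_le_1)
    qed (use assms that in auto)
    moreover have "1 - x\<^sup>2 > 0" using that by (auto simp: abs_square_less_1)
    ultimately show ?thesis by simp
  qed
  hence "{-1<..<1} \<subseteq> {x. poly p x = 0}" by auto
  moreover have "infinite {-1<..<1::real}" by simp
  ultimately show ?thesis using poly_roots_finite[of p] finite_subset by blast
qed

text \<open>After matching leading coefficients, the difference of the two polynomials of degree \<open>k\<close> has lower
  degree, hence is orthogonal to both of them and so to itself; thus it vanishes. The value at 1 then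
  fixes the scale.\<close>

lemma sym_jacobi_system_unique:
  assumes P: "sym_jacobi_system (real m) P" and P': "sym_jacobi_system (real m) P'"
  shows "P = P'"
proof
  fix k
  have deg: "degree (P k) = k" "degree (P' k) = k" 
    and one: "poly (P k) 1 = (real k + real m) gchoose k" "poly (P' k) 1 = (real k + real m) gchoose k"
    using P P' unfolding sym_jacobi_system_def by auto
  have nz: "(real k + real m) gchoose k \<noteq> 0"
    using binomial_gbinomial[of "k + m" k, where 'a = real] zero_less_binomial[of k "k + m"]
    by (metis le_add1 less_irrefl of_nat_0_less_iff of_nat_add)
  hence nz': "P k \<noteq> 0" "P' k \<noteq> 0" using one by auto
  define c where "c = lead_coeff (P k) / lead_coeff (P' k)"
  define D where "D = P k - smult c (P' k)"
  have "D = 0"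
  proof (cases k)
    case 0
    with deg obtain a b where ab: "P k = [:a:]" "P' k = [:b:]" by (metis degree_eq_zeroE)
    thus ?thesis using nz' by (simp add: D_def c_def)
  next
    case (Suc k')
    have "degree D \<le> k" unfolding D_def using deg by (intro degree_diff_le) (auto intro: order.trans[OF degree_smult_le])
    moreover have "coeff (P' k) k \<noteq> 0" using deg nz' by (metis leading_coeff_0_iff)
    hence "coeff D k = 0" using deg by (simp add: D_def c_def)
    ultimately have "degree D < k"
      by (metis Suc degree_0 le_neq_implies_less leading_coeff_0_iff zero_less_Suc)
    from sym_jacobi_system_orthogonal_lower[OF P this]
      has_integral_mult_right[OF sym_jacobi_system_orthogonal_lower[OF P' this], of c]
    have "((\<lambda>x. (1 - x\<^sup>2) ^ m * (poly (P k) x * poly D x) - c * ((1 - x\<^sup>2) ^ m * (poly (P' k) x * poly D x)))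
       has_integral (0 - c * 0)) {-1..1}"
      by (rule has_integral_diff)
    moreover have "(1 - x\<^sup>2) ^ m * (poly (P k) x * poly D x) - c * ((1 - x\<^sup>2) ^ m * (poly (P' k) x * poly D x))
       = (1 - x\<^sup>2) ^ m * (poly D x * poly D x)" for x
      by (simp add: D_def algebra_simps)
    ultimately show ?thesis using weighted_square_integral_0 by simp
  qed
  hence eq: "P k = smult c (P' k)" by (simp add: D_def)
  with one nz have "c = 1" by simp
  with eq show "P k = P' k" by simp
qed

lemma sym_jacobi_eq: "sym_jacobi (real m) (int k) = Jac m k"
proof -
  have "(THE P. sym_jacobi_system (real m) P) = Jac m"
    by (rule the_equality) (blast intro: sym_jacobi_system_Jac sym_jacobi_system_unique)+
  thus ?thesis by (simp add: sym_jacobi_def)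
qed

lemma legendre_eq: "legendre (int k) = Leg k"
  using sym_jacobi_eq[of 0 k] by (simp add: legendre_def Jac_def)

lemma legendre_neg: "k < 0 \<Longrightarrow> legendre k = 0"
  by (simp add: legendre_def sym_jacobi_def)

lemma pderiv_funpow_Leg:
  assumes "m \<le> k"
  shows "(pderiv ^^ m) (Leg k) = smult (pochhammer (real k + 1) m / 2 ^ m) (sym_jacobi (real m) (int k - int m))"
proof -
  have "pochhammer (real k + 1) m > 0" by (rule pochhammer_pos) simp
  thus ?thesis using sym_jacobi_eq[of m "k - m"] assms by (simp add: Jac_def of_nat_diff)
qed

section \<open>Zeros of the Legendre polynomials\<close>

text \<open>Rolle's theorem between neighbouring points of \<open>T\<close>, organized as an induction that adds a new
  largest point.\<close>

lemma rolle_finite: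
  fixes f f' :: "real \<Rightarrow> real"
  assumes f: "\<And>x. (f has_real_derivative f' x) (at x)"
  assumes "finite T" "T \<subseteq> {a..b}" "\<And>x. x \<in> T \<Longrightarrow> f x = 0"
  shows "\<exists>S. finite S \<and> card S = card T - 1 \<and> S \<subseteq> {a<..<b} \<and> (\<forall>x\<in>S. f' x = 0)"
  using assms(2-)
proof (induction T arbitrary: b rule: finite_linorder_max_induct)
  case empty
  show ?case by (rule exI[of _ "{}"]) simp
next
  case (insert y T)
  show ?case
  proof (cases "T = {}")
    case False
    define z where "z = Max T"
    have z: "z \<in> T" "T \<subseteq> {a..z}" "z < y"
      using insert False by (auto simp: z_def)
    from insert.IH[of z] z insert.prems obtain S where
      S: "finite S" "card S = card T - 1" "S \<subseteq> {a<..<z}" "\<forall>x\<in>S. f' x = 0" by auto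
    have "\<exists>u>z. u < y \<and> f' u = 0"
    proof -
      have "\<exists>u>z. u < y \<and> DERIV f u :> 0"
        using z insert.prems f
        by (intro Rolle) (auto intro!: continuous_at_imp_continuous_on DERIV_isCont simp: real_differentiable_def)
      thus ?thesis using f DERIV_unique by blast
    qed
    then obtain u where u: "z < u" "u < y" "f' u = 0" by blast
    have "card T > 0" using False insert.hyps by (simp add: card_gt_0_iff)
    have "y \<notin> T" "u \<notin> S" using insert.hyps S u by auto
    moreover have "insert u S \<subseteq> {a<..<b}"
      using S u z insert.prems by fastforce
    ultimately show ?thesis using S u \<open>card T > 0\<close> insert.hyps
      by (intro exI[of _ "insert u S"]) auto
  qed (auto intro: exI[of _ "{}"])
qed

text \<open>The function \<open>(1 - x\<^sup>2)\<^sup>m\<^sup>+\<^sup>1 y\<close>, with \<open>y\<close> the derivative of order \<open>m + 1\<close>, has two more zeros than \<open>y\<close> has in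
  \<open>(-1, 1)\<close>, namely the endpoints. By Rolle's theorem and the Sturm--Liouville equation the derivative
  of order \<open>m\<close> has one more interior zero than \<open>y\<close>. The induction starts with the derivative of
  order \<open>n\<close>, where there is nothing to show, and ends with \<open>n\<close> zeros of \<open>Leg n\<close> itself.\<close>

lemma Leg_deriv_roots:
  assumes "j \<le> n"
  shows "\<exists>S. finite S \<and> card S = j \<and> S \<subseteq> {-1<..<1} \<and> (\<forall>x\<in>S. poly ((pderiv ^^ (n - j)) (Leg n)) x = 0)"
  using assms
proof (induction j)
  case 0
  show ?case by (rule exI[of _ "{}"]) simp
next
  case (Suc j)
  define m where "m = n - Suc j"
  have m: "n - j = Suc m" "m < n" using Suc.prems by (auto simp: m_def)
  from Suc obtain T where T: "finite T" "card T = j" "T \<subseteq> {-1<..<1}" 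
    "\<forall>x\<in>T. poly ((pderiv ^^ Suc m) (Leg n)) x = 0" unfolding m by auto
  have "card (insert (-1) (insert 1 T)) = Suc (Suc j)"
    using T by (subst card_insert_disjoint; (subst card_insert_disjoint)?) auto
  moreover have "\<exists>S. finite S \<and> card S = card (insert (-1) (insert 1 T)) - 1 \<and> S \<subseteq> {-1<..<1} \<and>
    (\<forall>x\<in>S. - (real n - real m) * (real n + real m + 1) * ((1 - x\<^sup>2) ^ m * poly ((pderiv ^^ m) (Leg n)) x) = 0)"
    using T by (intro rolle_finite[OF Leg_sturm_liouville]) auto
  ultimately obtain S where S: "finite S" "card S = Suc j" "S \<subseteq> {-1<..<1}"
    "\<forall>x\<in>S. - (real n - real m) * (real n + real m + 1) * ((1 - x\<^sup>2) ^ m * poly ((pderiv ^^ m) (Leg n)) x) = 0"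
    by (metis diff_Suc_1)
  have "poly ((pderiv ^^ m) (Leg n)) x = 0" if "x \<in> S" for x
  proof -
    have "1 - x\<^sup>2 > 0" using that S by (auto simp: abs_square_less_1 abs_less_iff)
    with S that m show ?thesis by auto
  qed
  with S show ?case unfolding m_def by blast
qed

lemma card_Leg_roots: "card {x. poly (Leg n) x = 0} \<ge> n"
proof -
  have "Leg n \<noteq> 0" using degree_Leg_aux[of n] by auto
  from Leg_deriv_roots[of n n] obtain S where S: "card S = n" "\<forall>x\<in>S. poly (Leg n) x = 0" by auto
  show ?thesis using card_mono[OF poly_roots_finite[OF \<open>Leg n \<noteq> 0\<close>], of S] S by auto
qed

lemma gl_node_root:
  assumes "1 \<le> j" "j \<le> n"
  shows "poly (Leg n) (gl_node n j) = 0"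
proof -
  let ?A = "{x. poly (Leg n) x = 0}"
  have "Leg n \<noteq> 0" using degree_Leg_aux[of n] by auto
  hence fin: "finite ?A" by (rule poly_roots_finite)
  hence "length (sorted_list_of_set ?A) \<ge> n" using card_Leg_roots[of n] by simp
  hence "gl_node n j \<in> set (sorted_list_of_set ?A)"
    unfolding gl_node_def legendre_eq using assms by (intro nth_mem) auto
  with fin show ?thesis by simp
qed

section \<open>The Christoffel--Darboux kernel\<close>

lemma christoffel_darboux:
  "(x - y) * (\<Sum>k\<le>n. (2 * real k + 1) * poly (Leg k) x * poly (Leg k) y) =
     (real n + 1) * (poly (Leg (Suc n)) x * poly (Leg n) y - poly (Leg n) x * poly (Leg (Suc n)) y)"
proof (induction n)
  case (Suc n)
  have "(x - y) * (\<Sum>k\<le>Suc n. (2 * real k + 1) * poly (Leg k) x * poly (Leg k) y) =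
     (real n + 1) * (poly (Leg (Suc n)) x * poly (Leg n) y - poly (Leg n) x * poly (Leg (Suc n)) y)
     + (x - y) * ((2 * real n + 3) * poly (Leg (Suc n)) x * poly (Leg (Suc n)) y)"
    using Suc by (simp add: distrib_left)
  also have "\<dots> = (real n + 2) * poly (Leg (Suc (Suc n))) x * poly (Leg (Suc n)) y 
     - poly (Leg (Suc n)) x * ((real n + 2) * poly (Leg (Suc (Suc n))) y)"
    unfolding Leg_recurrence by algebra
  finally show ?case by (simp add: algebra_simps)
qed simp

lemma legendre_R_eq:
  "legendre_R 0 y = y" "legendre_R (Suc k) y = poly (Leg (Suc (Suc k))) y - poly (Leg k) y"
proof -
  show "legendre_R 0 y = y"
    using legendre_eq[of 1] by (simp add: legendre_R_def legendre_neg)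
  show "legendre_R (Suc k) y = poly (Leg (Suc (Suc k))) y - poly (Leg k) y"
    using legendre_eq[of "Suc (Suc k)"] legendre_eq[of k] by (simp add: legendre_R_def add_ac)
qed

text \<open>Summation by parts applied to \<open>\<Sum> (Leg (k + 1) - Leg (k - 1)) Leg k (y)\<close>, an antiderivative of the
  kernel in \<open>x\<close>. The term with \<open>Leg (n + 1) (y)\<close> is kept so that the induction on \<open>n\<close> works for
  arbitrary \<open>y\<close>; it vanishes when \<open>y\<close> is a zero of \<open>Leg (n + 1)\<close>.\<close>

lemma pderiv_kernel_antiderivative:
  "poly (pderiv (smult (poly (Leg n) y) (Leg (Suc n)) + smult (poly (Leg (Suc n)) y) (Leg n)
     - (\<Sum>k\<le>n. smult (legendre_R k y) (Leg k)))) x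
   = (\<Sum>k\<le>n. (2 * real k + 1) * poly (Leg k) x * poly (Leg k) y)"
proof (induction n)
  case 0
  show ?case by (simp add: legendre_R_eq pderiv_pCons)
next
  case (Suc n)
  have "poly (pderiv (Leg (Suc (Suc n)))) x = poly (pderiv (Leg n)) x + (2 * real n + 3) * poly (Leg (Suc n)) x"
    using pderiv_Leg_diff[of n x] by simp
  with Suc show ?case
    by (simp add: legendre_R_eq pderiv_add pderiv_diff pderiv_smult algebra_simps)
qed

section \<open>The Gauss--Legendre polynomials\<close>

lemma gl_b_quotient:
  assumes "1 \<le> j" "j \<le> n"
  shows "\<exists>q. Leg n = [:- gl_node n j, 1:] * q \<and> (\<forall>x. poly q x = (\<Sum>k<n. gl_b n j k * (x + 1) ^ k))"
proof -
  let ?t = "gl_node n j"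
  obtain q where q: "Leg n = [:- ?t, 1:] * q"
    using gl_node_root[OF assms] by (auto simp: poly_eq_0_iff_dvd)
  have "Leg n \<noteq> 0" using degree_Leg_aux[of n] by auto
  with q have "q \<noteq> 0" by auto
  hence deg: "degree q < n" using q degree_Leg[of n] degree_mult_eq[of "[:- ?t, 1:]" q] by simp
  \<comment> \<open>The Taylor coefficients of the quotient at -1 are the coefficients of its shift.\<close>
  define s where "s = pcompose q [:-1, 1:]"
  have s: "poly s (x + 1) = poly q x" for x by (simp add: s_def poly_pcompose)
  have degs: "degree s < n" using deg by (simp add: s_def degree_pcompose)
  have *: "poly q x = (\<Sum>k<n. coeff s k * (x + 1) ^ k)" for x
  proof -
    have "poly q x = (\<Sum>k\<le>degree s. coeff s k * (x + 1) ^ k)"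
      unfolding s[symmetric] by (rule poly_altdef)
    also have "\<dots> = (\<Sum>k<n. coeff s k * (x + 1) ^ k)"
      using degs by (intro sum.mono_neutral_left) (auto simp: coeff_eq_0)
    finally show ?thesis .
  qed
  have quot: "poly (Leg n) x / (x - ?t) = poly q x" if "x \<noteq> ?t" for x
    using that by (simp add: q field_simps)
  have "gl_b n j = coeff s"
    unfolding gl_b_def legendre_eq
  proof (rule the_equality)
    show "(\<forall>k\<ge>n. coeff s k = 0) \<and>
      (\<forall>x. x \<noteq> ?t \<longrightarrow> poly (Leg n) x / (x - ?t) = (\<Sum>k<n. coeff s k * (x + 1) ^ k))"
      using degs quot * by (auto simp: coeff_eq_0)
  next
    fix b assume b: "(\<forall>k\<ge>n. b k = 0) \<and>
      (\<forall>x. x \<noteq> ?t \<longrightarrow> poly (Leg n) x / (x - ?t) = (\<Sum>k<n. b k * (x + 1) ^ k))"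
    define r where "r = (\<Sum>k<n. monom (b k) k)"
    have "poly (r - s) y = 0" if "y \<noteq> ?t + 1" for y
      using b that quot[of "y - 1"] s[of "y - 1"] by (auto simp: r_def poly_sum poly_monom)
    hence "- {?t + 1} \<subseteq> {y. poly (r - s) y = 0}" by auto
    moreover have "infinite (- {?t + 1})" by (simp add: finite_compl infinite_UNIV_char_0)
    ultimately have "r - s = 0" using poly_roots_finite finite_subset by blast
    hence "coeff s k = coeff r k" for k by simp
    also have "coeff r k = b k" for k
      using b by (auto simp: r_def coeff_sum if_distrib not_less cong: if_cong)
    finally show "b = coeff s" by auto
  qed
  with * q show ?thesis by auto
qed

lemma gl_b_kernel:
  assumes "1 \<le> j" "j \<le> n"
  shows "real n * poly (Leg (n - 1)) (gl_node n j) * (\<Sum>k<n. gl_b n j k * (x + 1) ^ k)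
     = (\<Sum>k<n. (2 * real k + 1) * poly (Leg k) x * poly (Leg k) (gl_node n j))"
proof -
  let ?t = "gl_node n j"
  obtain N where N: "n = Suc N" using assms by (cases n) auto
  obtain q where q: "Leg n = [:- ?t, 1:] * q" and b: "\<And>x. poly q x = (\<Sum>k<n. gl_b n j k * (x + 1) ^ k)"
    using gl_b_quotient[OF assms] by blast
  define K where "K = (\<Sum>k<n. smult ((2 * real k + 1) * poly (Leg k) ?t) (Leg k))"
  have K: "poly K x = (\<Sum>k<n. (2 * real k + 1) * poly (Leg k) x * poly (Leg k) ?t)" for x
    by (simp add: K_def poly_sum mult_ac)
  have "[:- ?t, 1:] * K = [:- ?t, 1:] * smult (real n * poly (Leg N) ?t) q"
  proof (rule poly_ext)
    fix x
    have "(x - ?t) * poly K x = real n * (poly (Leg n) x * poly (Leg N) ?t)"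
      using christoffel_darboux[of x ?t N] gl_node_root[OF assms] 
      by (simp add: K N lessThan_Suc_atMost)
    also have "poly (Leg n) x = (x - ?t) * poly q x" by (simp add: q algebra_simps)
    finally show "poly ([:- ?t, 1:] * K) x = poly ([:- ?t, 1:] * smult (real n * poly (Leg N) ?t) q) x"
      by (simp add: algebra_simps)
  qed
  hence "K = smult (real n * poly (Leg N) ?t) q" by (subst (asm) mult_cancel_left) simp
  with K[of x] b[of x] N show ?thesis by simp
qed

lemma gl_G_eq:
  assumes "1 \<le> j" "j \<le> n"
  shows "gl_G n j t = real n * poly (Leg (n - 1)) (gl_node n j) / 2 *
     (\<Sum>k<n. gl_b n j k / real (Suc k) * (t + 1) ^ Suc k) - 1 / 2"
proof -
  let ?t = "gl_node n j"
  obtain q where q: "Leg n = [:- ?t, 1:] * q" and b: "\<And>x. poly q x = (\<Sum>k<n. gl_b n j k * (x + 1) ^ k)"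
    using gl_b_quotient[OF assms] by blast
  have "(LBINT x=-1..ereal t. poly (Leg n) x / (x - ?t)) = (LBINT x=ereal (-1)..ereal t. poly q x)"
  proof -
    have [measurable]: "poly p \<in> borel_measurable borel" for p :: "real poly"
      by (intro borel_measurable_continuous_onI continuous_intros)
    have "AE x in lborel. x \<noteq> ?t" by (rule AE_lborel_singleton)
    moreover have "poly (Leg n) x / (x - ?t) = poly q x" if "x \<noteq> ?t" for x
      using that by (simp add: q field_simps)
    ultimately have "AE x in lborel. poly (Leg n) x / (x - ?t) = poly q x" by auto
    hence "(LBINT x=ereal (-1)..ereal t. poly (Leg n) x / (x - ?t)) = (LBINT x=ereal (-1)..ereal t. poly q x)"
      by (intro interval_integral_cong_AE) auto
    thus ?thesis by (simp add: one_ereal_def)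
  qed
  also have "\<dots> = (\<Sum>k<n. gl_b n j k / real (Suc k) * (t + 1) ^ Suc k)
      - (\<Sum>k<n. gl_b n j k / real (Suc k) * (-1 + 1) ^ Suc k)"
  proof (rule interval_integral_FTC_finite)
    fix x
    have "((\<lambda>x. \<Sum>k<n. gl_b n j k / real (Suc k) * (x + 1) ^ Suc k) has_real_derivative
      (\<Sum>k<n. gl_b n j k / real (Suc k) * (real (Suc k) * (x + 1) ^ k))) (at x within {min (-1) t..max (-1) t})"
      by (intro DERIV_sum DERIV_cmult) (rule derivative_eq_intros refl | simp)+
    also have "(\<Sum>k<n. gl_b n j k / real (Suc k) * (real (Suc k) * (x + 1) ^ k)) = poly q x"
      unfolding b by (intro sum.cong refl) (simp del: of_nat_Suc)
    finally show "((\<lambda>x. \<Sum>k<n. gl_b n j k / real (Suc k) * (x + 1) ^ Suc k) has_vector_derivative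
      poly q x) (at x within {min (-1) t..max (-1) t})"
      by (simp add: has_real_derivative_iff_has_vector_derivative)
  qed (intro continuous_intros)
  finally show ?thesis
    using assms legendre_eq[of n] legendre_eq[of "n - 1"] by (simp add: gl_G_def of_nat_diff)
qed

lemma gl_F_eq:
  assumes "1 \<le> i" "i \<le> n - 1"
  shows "gl_F n i t = (\<Sum>k=1..n. gl_c n i k * (t + 1) ^ k)"
proof -
  have i: "1 \<le> i" "i \<le> n" "1 \<le> i + 1" "i + 1 \<le> n" using assms by auto
  have prev: "legendre (int n - 1) = Leg (n - 1)" using legendre_eq[of "n - 1"] i by (simp add: of_nat_diff)
  have "(\<Sum>k=1..n. gl_c n i k * (t + 1) ^ k) = (\<Sum>k<n. gl_c n i (Suc k) * (t + 1) ^ Suc k)"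
    using sum.atLeast1_atMost_eq[of "\<lambda>k. gl_c n i k * (t + 1) ^ k" n] by simp
  also have "\<dots> = (\<Sum>k<n. 
      real n * poly (Leg (n - 1)) (gl_node n i) / 2 * (gl_b n i k / real (Suc k) * (t + 1) ^ Suc k)
    - real n * poly (Leg (n - 1)) (gl_node n (i + 1)) / 2 * (gl_b n (i + 1) k / real (Suc k) * (t + 1) ^ Suc k))"
    by (intro sum.cong refl) (simp add: gl_c_def prev field_simps del: of_nat_Suc power_Suc)
  also have "\<dots> = gl_F n i t"
    unfolding gl_F_def gl_G_eq[OF i(1,2)] gl_G_eq[OF i(3,4)] by (simp add: sum_subtractf sum_distrib_left)
  finally show ?thesis ..
qed

section \<open>Higher derivatives and the two expansions\<close>

lemma higher_deriv_poly: "(deriv ^^ m) (poly p) = poly ((pderiv ^^ m) p)" for p :: "real poly"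
  by (induction m) (auto intro!: ext DERIV_imp_deriv)

text \<open>The factors \<open>k - m + 1, \<dots>, k\<close> include 0 here. Hence the formula below for derivatives of powers is
  valid also beyond the degree, where the truncated exponent \<open>k - m\<close> carries no meaning.\<close>

lemma pochhammer_falling_eq_0: "k < m \<Longrightarrow> pochhammer (real k - real m + 1) m = 0"
  by (auto simp: pochhammer_eq_0_iff of_nat_diff intro!: exI[of _ "m - Suc k"])

lemma higher_pderiv_shifted_power:
  "(pderiv ^^ m) ([:1, 1:] ^ k) = smult (pochhammer (real k - real m + 1) m) ([:1, 1:] ^ (k - m))"
proof (induction m)
  case (Suc m)
  have "pderiv ([:1, 1:] ^ l) = smult (real l) ([:1, 1:] ^ (l - 1))" for l
    by (cases l) (simp_all add: pderiv_power_Suc pderiv_pCons del: power_Suc)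
  hence "(pderiv ^^ Suc m) ([:1, 1:] ^ k) =
    smult (pochhammer (real k - real m + 1) m * real (k - m)) ([:1, 1:] ^ (k - Suc m))"
    using Suc by (simp add: pderiv_smult)
  also have "pochhammer (real k - real m + 1) m * real (k - m) = pochhammer (real k - real (Suc m) + 1) (Suc m)"
  proof (cases "m \<le> k")
    case True
    thus ?thesis by (simp add: pochhammer_rec of_nat_diff algebra_simps)
  next
    case False
    thus ?thesis using pochhammer_falling_eq_0[of k "Suc m"] by simp
  qed
  finally show ?case .
qed simp

theorem mainTheorem4:
  fixes n i m :: nat and t :: real
  assumes "n \<ge> 1" and "1 \<le> i" and "i \<le> n - 1" and "m > 0"
  shows "(deriv ^^ m) (gl_F n i) t =
           (\<Sum>k=m..n. pochhammer (real k - real m + 1) m * gl_c n i k * (t + 1) ^ (k - m))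
       \<and> (deriv ^^ m) (gl_F n i) t =
           pochhammer (real n + 1) m / 2 ^ (m + 1) *
             (poly (legendre (int n - 1)) (gl_node n i) -
              poly (legendre (int n - 1)) (gl_node n (i + 1))) *
             poly (sym_jacobi (real m) (int n - int m)) t
           + 1 / 2 ^ (m + 1) *
             (\<Sum>k=m..n - 1. pochhammer (real k + 1) m * gl_d n i k *
                poly (sym_jacobi (real m) (int k - int m)) t)"
proof -
  define A where "A = (\<Sum>k=1..n. smult (gl_c n i k) ([:1, 1:] ^ k))"
  have F: "gl_F n i = poly A"
    using gl_F_eq[OF assms(2,3)] by (auto simp: A_def poly_sum add.commute)
  hence D: "(deriv ^^ m) (gl_F n i) t = poly ((pderiv ^^ m) A) t"
    by (simp add: higher_deriv_poly)

  have 1: "poly ((pderiv ^^ m) A) t = 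
      (\<Sum>k=m..n. pochhammer (real k - real m + 1) m * gl_c n i k * (t + 1) ^ (k - m))"
  proof -
    have "poly ((pderiv ^^ m) A) t = 
        (\<Sum>k=1..n. pochhammer (real k - real m + 1) m * gl_c n i k * (t + 1) ^ (k - m))"
      by (simp add: A_def higher_pderiv_sum higher_pderiv_smult higher_pderiv_shifted_power poly_sum mult_ac add_ac)
    also have "\<dots> = (\<Sum>k=m..n. pochhammer (real k - real m + 1) m * gl_c n i k * (t + 1) ^ (k - m))"
    proof (rule sum.mono_neutral_right)
      show "\<forall>k\<in>{1..n} - {m..n}. pochhammer (real k - real m + 1) m * gl_c n i k * (t + 1) ^ (k - m) = 0"
        by (auto simp: pochhammer_falling_eq_0)
    qed (use assms in auto)
    finally show ?thesis .
  qed

  obtain N where N: "n = Suc N" using assms by (cases n) auto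
  define x y where "x = gl_node n i" and "y = gl_node n (i + 1)"
  have root: "poly (Leg (Suc N)) x = 0" "poly (Leg (Suc N)) y = 0"
    unfolding x_def y_def N[symmetric] using assms by (auto intro!: gl_node_root)
  define B where "B = smult (1 / 2) (smult (poly (Leg N) x - poly (Leg N) y) (Leg n) 
     + (\<Sum>k<n. smult (gl_d n i k) (Leg k)))"
  define M where "M = (\<lambda>y. smult (poly (Leg N) y) (Leg (Suc N)) + smult (poly (Leg (Suc N)) y) (Leg N)
     - (\<Sum>k\<le>N. smult (legendre_R k y) (Leg k)))"
  have d: "gl_d (Suc N) i k = legendre_R k y - legendre_R k x" for k
    by (simp add: gl_d_def x_def y_def N)
  \<comment> \<open>At a zero of \<open>Leg n\<close>, the middle term of \<open>M\<close> vanishes.\<close>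
  have BM: "B = smult (1 / 2) (M x - M y)"
    by (rule poly_ext) (simp add: B_def M_def N root poly_sum d lessThan_Suc_atMost
        sum_subtractf algebra_simps)
  have "pderiv A = pderiv B"
  proof (rule poly_ext)
    fix u
    have prev: "legendre (int n - 1) = Leg (n - 1)" using legendre_eq[of N] by (simp add: N)
    have A': "pderiv A = (\<Sum>k=1..n. smult (gl_c n i k * real k) ([:1, 1:] ^ (k - 1)))"
      using higher_pderiv_sum[of 1 "\<lambda>k. smult (gl_c n i k) ([:1, 1:] ^ k)" "{1..n}"]
      unfolding A_def higher_pderiv_smult higher_pderiv_shifted_power by simp
    have "poly (pderiv A) u = (\<Sum>k<n. gl_c n i (Suc k) * real (Suc k) * (u + 1) ^ k)"
      unfolding A' using sum.atLeast1_atMost_eq[of "\<lambda>k. gl_c n i k * real k * (u + 1) ^ (k - 1)" n]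
      by (simp add: poly_sum add.commute)
    also have "\<dots> = (\<Sum>k<n. 1 / 2 * (real n * poly (Leg (n - 1)) x * (gl_b n i k * (u + 1) ^ k)
        - real n * poly (Leg (n - 1)) y * (gl_b n (i + 1) k * (u + 1) ^ k)))"
      by (intro sum.cong refl) (simp add: gl_c_def prev x_def y_def field_simps del: of_nat_Suc)
    also have "\<dots> = 1 / 2 * (real n * poly (Leg (n - 1)) x * (\<Sum>k<n. gl_b n i k * (u + 1) ^ k)
        - real n * poly (Leg (n - 1)) y * (\<Sum>k<n. gl_b n (i + 1) k * (u + 1) ^ k))"
      by (simp add: sum_subtractf sum_distrib_left right_diff_distrib)
    also have "\<dots> = 1 / 2 * ((\<Sum>k<n. (2 * real k + 1) * poly (Leg k) u * poly (Leg k) x)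
        - (\<Sum>k<n. (2 * real k + 1) * poly (Leg k) u * poly (Leg k) y))"
      using gl_b_kernel[of i n u] gl_b_kernel[of "i + 1" n u] assms by (simp add: x_def y_def)
    also have "\<dots> = 1 / 2 * (poly (pderiv (M x)) u - poly (pderiv (M y)) u)"
      unfolding M_def pderiv_kernel_antiderivative by (simp add: N lessThan_Suc_atMost)
    also have "\<dots> = poly (pderiv B) u"
      by (simp add: BM pderiv_smult pderiv_diff)
    finally show "poly (pderiv A) u = poly (pderiv B) u" .
  qed
  hence "(pderiv ^^ m) A = (pderiv ^^ m) B"
    using \<open>m > 0\<close> by (cases m) (simp_all add: funpow_Suc_right del: funpow.simps)
  also have "poly \<dots> t = pochhammer (real n + 1) m / 2 ^ (m + 1) *
             (poly (legendre (int n - 1)) (gl_node n i) -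
              poly (legendre (int n - 1)) (gl_node n (i + 1))) *
             poly (sym_jacobi (real m) (int n - int m)) t
           + 1 / 2 ^ (m + 1) *
             (\<Sum>k=m..n - 1. pochhammer (real k + 1) m * gl_d n i k *
                poly (sym_jacobi (real m) (int k - int m)) t)"
  proof -
    have prev: "legendre (int n - 1) = Leg N" using legendre_eq[of N] by (simp add: N)
    \<comment> \<open>For \<open>k < m\<close> the left side vanishes by degree, the right side by the convention for negative degrees.\<close>
    have low: "poly ((pderiv ^^ m) (Leg k)) t = pochhammer (real k + 1) m / 2 ^ m * 
       poly (sym_jacobi (real m) (int k - int m)) t" for k
    proof (cases "m \<le> k")
      case False
      hence "(pderiv ^^ m) (Leg k) = 0"
        by (intro poly_eqI) (simp add: coeff_higher_pderiv coeff_eq_0 degree_Leg)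
      with False show ?thesis by (simp add: sym_jacobi_def)
    qed (simp add: pderiv_funpow_Leg)
    have "poly ((pderiv ^^ m) B) t = 1 / 2 * ((poly (Leg N) x - poly (Leg N) y) * poly ((pderiv ^^ m) (Leg n)) t
       + (\<Sum>k<n. gl_d n i k * poly ((pderiv ^^ m) (Leg k)) t))"
      by (simp add: B_def higher_pderiv_smult higher_pderiv_add higher_pderiv_sum poly_sum)
    also have "(\<Sum>k<n. gl_d n i k * poly ((pderiv ^^ m) (Leg k)) t) = 
       (\<Sum>k=m..n - 1. gl_d n i k * poly ((pderiv ^^ m) (Leg k)) t)"
      by (rule sum.mono_neutral_right) (auto simp: N low sym_jacobi_def)
    also have "\<dots> = 1 / 2 ^ m * (\<Sum>k=m..n - 1. pochhammer (real k + 1) m * gl_d n i k *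
                poly (sym_jacobi (real m) (int k - int m)) t)"
      by (simp add: low sum_distrib_left sum_divide_distrib mult_ac)
    finally show ?thesis
      by (simp add: low prev x_def y_def field_simps)
  qed
  finally show ?thesis using D 1 by simp
qed

end
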